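(* If $f\in H^1(\mathbb{T}^\infty)$ is not identically zero (as an element of $L^1(\mathbb{T}^\infty)$), then $\log|f|\in L^1(\mathbb{T}^\infty)$.
   Context: $\mathbb{T}$ is the unit circle and $\mathbb{T}^\infty=\{(z_1,z_2,\ldots):z_n\in\mathbb{T}\}$ is the compact abelian group (product topology) with normalized Haar measure $d\theta=d\theta_1\times d\theta_2\times\cdots$. $\mathbb{Z}^\infty_0$ is the set of integer sequences $\nu$ with only finitely many non-zero entries, and $\mathbb{N}^\infty_0$ is the subset of those with all entries $\ge0$. $H^1(\mathbb{T}^\infty)$ is the space of $f\in L^1(\mathbb{T}^\infty)$ with $\widehat f(\nu)=\int_{\mathbb{T}^\infty}f(e^{i\theta})e^{-i\nu\cdot\theta}\,d\theta=0$ for all $\nu\in\mathbb{Z}^\infty_0\setminus\mathbb{N}^\infty_0$. *)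

theory Defs
  imports "HOL-Probability.Probability"
begin

definition circle_measure :: "complex measure" where
  "circle_measure =
     distr (uniform_measure lborel {0..2 * pi}) (restrict_space borel (sphere 0 1)) cis"

text \<open>
  Functions are measurable with respect to the product \<open>\<sigma>\<close>-algebra, which is the Borel
  \<open>\<sigma>\<close>-algebra of the product topology because the index set is countable. The coordinates
  $z_1, z_2, \ldots$ are indexed from 0.
\<close>

definition torus_measure :: "(nat \<Rightarrow> complex) measure" where
  "torus_measure = PiM UNIV (\<lambda>_. circle_measure)"

definition Z0_inf :: "(nat \<Rightarrow> int) set" where
  "Z0_inf = {\<nu>. finite {n. \<nu> n \<noteq> 0}}"

definition N0_inf :: "(nat \<Rightarrow> int) set" where
  "N0_inf = {\<nu> \<in> Z0_inf. \<forall>n. 0 \<le> \<nu> n}"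

text \<open>With $z_n = e^{i\theta_n}$, the product below is $e^{-i \nu\cdot\theta}$.\<close>

definition fourier_coeff :: "((nat \<Rightarrow> complex) \<Rightarrow> complex) \<Rightarrow> (nat \<Rightarrow> int) \<Rightarrow> complex" where
  "fourier_coeff f \<nu> =
     (\<integral>z. f z * (\<Prod>n | \<nu> n \<noteq> 0. z n powi (- \<nu> n)) \<partial>torus_measure)"

text \<open>Elements of \<open>H1_inf\<close> are functions, not classes modulo null sets.\<close>

definition H1_inf :: "((nat \<Rightarrow> complex) \<Rightarrow> complex) set" where
  "H1_inf = {f. integrable torus_measure f \<and> (\<forall>\<nu> \<in> Z0_inf - N0_inf. fourier_coeff f \<nu> = 0)}"

lemma space_circle_measure: "space circle_measure = sphere 0 1"
  by (simp add: circle_measure_def space_restrict_space)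

lemma measurable_cis_circle [measurable]:
  "cis \<in> measurable borel (restrict_space borel (sphere 0 1))"
  by (intro measurable_restrict_space2 borel_measurable_continuous_onI continuous_intros) auto

lemma prob_space_circle_measure: "prob_space circle_measure"
proof -
  interpret prob_space "uniform_measure lborel {0..2 * pi}"
    by (rule prob_space_uniform_measure) auto
  have "cis \<in> measurable (uniform_measure lborel {0..2 * pi}) (restrict_space borel (sphere 0 1))"
    using measurable_cis_circle by (simp cong: measurable_cong_sets)
  then show ?thesis
    unfolding circle_measure_def by (rule prob_space_distr)
qed

lemma prob_space_torus_measure: "prob_space torus_measure"
  unfolding torus_measure_def by (intro prob_space_PiM prob_space_circle_measure)

lemma space_torus_measure: "space torus_measure = {z. \<forall>n. z n \<in> sphere 0 1}"
  by (auto simp: torus_measure_def space_PiM space_circle_measure PiE_def Pi_def)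

end

theory Submission
  imports Defs
begin

text \<open>
  The proof is the Helson--Lowdenslager form of Jensen's inequality, arranged so that only duality
  is needed and no boundary values or factorization.

  \<^bold>\<open>Reduction to non-zero mean.\<close> Order the frequencies by the sign of the last non-zero entry
  (reverse lexicographic order). This is a total group order on \<open>Z0_inf\<close>, and it well-orders
  \<open>N0_inf\<close> (\<open>N0_inf_has_min\<close>). A non-zero \<open>f\<close> has a non-zero Fourier coefficient
  (\<open>AE_0_of_fourier_coeffs_0\<close>); let \<open>m\<close> be the smallest frequency with this property and put
  \<open>g = f \<cdot> character (- m)\<close>. Then \<open>|g| = |f|\<close>, the mean \<open>a\<close> of \<open>g\<close> is non-zero, and all
  non-zero frequencies of \<open>g\<close> are positive.

  \<^bold>\<open>The inequality.\<close> If \<open>q\<close> is a trigonometric polynomial with positive frequencies, then so is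
  every power \<open>q^k\<close> with \<open>k \<ge> 1\<close>; hence \<open>g\<close> is orthogonal to the conjugate of each of these,
  and \<open>\<integral> g exp q = a\<close>. Since the order is total, every real trigonometric polynomial of mean zero
  is the real part of such a \<open>q\<close>. Taking absolute values, \<open>|a| exp (\<integral> u) \<le> \<integral> |g| exp u\<close>
  for real trigonometric polynomials \<open>u\<close>, and by density for all bounded measurable \<open>u\<close>
  (\<open>exp_mean_le\<close>).

  \<^bold>\<open>Conclusion.\<close> Take for \<open>u\<close> the function \<open>- log |g|\<close> truncated to \<open>[0, n]\<close>. Then
  \<open>|g| exp u \<le> 1 + |g|\<close>, so \<open>\<integral> u \<le> log ((1 + \<integral> |g|) / |a|)\<close> uniformly in \<open>n\<close>, and
  monotone convergence makes the negative part of \<open>log |g|\<close> integrable. The positive part is at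
  most \<open>|g|\<close>.
\<close>

section \<open>Reverse lexicographic order on the frequencies\<close>

text \<open>
  The positive cone of the reverse lexicographic order. The last non-zero entry decides, not the
  first: in the lexicographic order the unit frequencies of the successive coordinates would form
  an infinite descending chain in \<open>N0_inf\<close>.
\<close>

definition pos_freq :: "(nat \<Rightarrow> int) set" where
  "pos_freq = {\<nu> \<in> Z0_inf. \<exists>N. 0 < \<nu> N \<and> (\<forall>n>N. \<nu> n = 0)}"

lemma Z0_inf_add: "\<nu> \<in> Z0_inf \<Longrightarrow> \<mu> \<in> Z0_inf \<Longrightarrow> (\<lambda>n. \<nu> n + \<mu> n) \<in> Z0_inf"
  unfolding Z0_inf_def
  by (auto intro: finite_subset[of _ "{n. \<nu> n \<noteq> 0} \<union> {n. \<mu> n \<noteq> 0}"])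

lemma Z0_inf_uminus: "\<nu> \<in> Z0_inf \<Longrightarrow> (\<lambda>n. - \<nu> n) \<in> Z0_inf"
  by (simp add: Z0_inf_def)

lemma Z0_inf_0: "(\<lambda>_. 0) \<in> Z0_inf"
  by (simp add: Z0_inf_def)

lemma pos_freq_subset: "pos_freq \<subseteq> Z0_inf"
  by (auto simp: pos_freq_def)

lemma zero_notin_pos_freq: "(\<lambda>_. 0) \<notin> pos_freq"
  by (simp add: pos_freq_def)

lemma pos_freq_add:
  assumes "\<nu> \<in> pos_freq" "\<mu> \<in> pos_freq"
  shows "(\<lambda>n. \<nu> n + \<mu> n) \<in> pos_freq"
proof -
  obtain N where N: "0 < \<nu> N" "\<And>n. n > N \<Longrightarrow> \<nu> n = 0"
    using assms by (auto simp: pos_freq_def)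
  obtain M where M: "0 < \<mu> M" "\<And>n. n > M \<Longrightarrow> \<mu> n = 0"
    using assms by (auto simp: pos_freq_def)
  have "0 < \<nu> (max N M) + \<mu> (max N M)"
    using N M by (cases N M rule: linorder_cases) (auto simp: max_def)
  moreover have "\<forall>n>max N M. \<nu> n + \<mu> n = 0"
    using N M by simp
  ultimately show ?thesis
    using assms Z0_inf_add[of \<nu> \<mu>] unfolding pos_freq_def by blast
qed

lemma top_index:
  assumes "\<nu> \<in> Z0_inf" "\<nu> k \<noteq> 0"
  obtains N where "k \<le> N" "\<nu> N \<noteq> 0" "\<And>n. n > N \<Longrightarrow> \<nu> n = 0"
proof
  have fin: "finite {n. \<nu> n \<noteq> 0}" and k: "k \<in> {n. \<nu> n \<noteq> 0}"
    using assms by (auto simp: Z0_inf_def)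
  show "k \<le> Max {n. \<nu> n \<noteq> 0}"
    using fin k by (rule Max_ge)
  show "\<nu> (Max {n. \<nu> n \<noteq> 0}) \<noteq> 0"
    using Max_in[OF fin] k by blast
  show "\<nu> n = 0" if "n > Max {n. \<nu> n \<noteq> 0}" for n
    using Max_ge[OF fin, of n] that by force
qed

lemma pos_freq_trichotomy:
  assumes "\<nu> \<in> Z0_inf"
  shows "\<nu> = (\<lambda>_. 0) \<or> \<nu> \<in> pos_freq \<or> (\<lambda>n. - \<nu> n) \<in> pos_freq"
proof (cases "\<nu> = (\<lambda>_. 0)")
  case False
  then obtain k where "\<nu> k \<noteq> 0" by blast
  then obtain N where N: "\<nu> N \<noteq> 0" "\<And>n. n > N \<Longrightarrow> \<nu> n = 0"
    using top_index[OF assms] by metis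
  then consider "0 < \<nu> N" | "0 < - \<nu> N" by linarith
  then show ?thesis
    by cases (use N assms Z0_inf_uminus[OF assms] in \<open>auto simp: pos_freq_def\<close>)
qed simp

text \<open>
  The coordinates from \<open>N\<close> on are the same throughout \<open>X\<close>, so the order on \<open>X\<close> depends only on the
  first \<open>N\<close> of them. Minimizing coordinate \<open>N - 1\<close> and keeping only the minimizers reduces \<open>N\<close> by
  one.
\<close>

lemma ex_min_agreeing_above:
  assumes "X \<noteq> {}" "X \<subseteq> N0_inf"
    and "\<And>x y n. x \<in> X \<Longrightarrow> y \<in> X \<Longrightarrow> N \<le> n \<Longrightarrow> x n = y n"
  shows "\<exists>m\<in>X. \<forall>x\<in>X. x = m \<or> (\<lambda>n. x n - m n) \<in> pos_freq"
  using assms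
proof (induction N arbitrary: X)
  case 0
  then obtain m where "m \<in> X" by blast
  with "0.prems"(3) show ?case by (intro bexI[of _ m]) (auto simp: fun_eq_iff)
next
  case (Suc N)
  obtain x0 where x0: "x0 \<in> X" using Suc.prems by blast
  define y where "y = arg_min (\<lambda>x. nat (x N)) (\<lambda>x. x \<in> X)"
  have y: "y \<in> X" and y_min: "\<And>x. x \<in> X \<Longrightarrow> nat (y N) \<le> nat (x N)"
    using arg_min_nat_lemma[of "\<lambda>x. x \<in> X" x0 "\<lambda>x. nat (x N)"] x0 by (auto simp: y_def)
  have nonneg: "0 \<le> x N" if "x \<in> X" for x
    using Suc.prems(2) that by (auto simp: N0_inf_def)
  have "\<exists>m\<in>{x \<in> X. x N = y N}. \<forall>x\<in>{x \<in> X. x N = y N}. x = m \<or> (\<lambda>n. x n - m n) \<in> pos_freq"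
  proof (rule Suc.IH)
    fix x x' n assume "x \<in> {x \<in> X. x N = y N}" "x' \<in> {x \<in> X. x N = y N}" "N \<le> n"
    then show "x n = x' n"
      using Suc.prems(3)[of x x' n] by (cases "n = N") auto
  qed (use y Suc.prems in auto)
  then obtain m where m: "m \<in> X" "m N = y N"
    and m_min: "\<And>x. x \<in> X \<Longrightarrow> x N = y N \<Longrightarrow> x = m \<or> (\<lambda>n. x n - m n) \<in> pos_freq"
    by blast
  show ?case
  proof (intro bexI[of _ m] ballI)
    fix x assume x: "x \<in> X"
    show "x = m \<or> (\<lambda>n. x n - m n) \<in> pos_freq"
    proof (cases "x N = y N")
      case False
      then have "0 < x N - m N"
        using y_min[OF x] nonneg[OF x] nonneg[OF y] m by linarith
      moreover have "\<forall>n>N. x n - m n = 0"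
        using Suc.prems(3)[OF x m(1)] by simp
      moreover have "(\<lambda>n. x n - m n) \<in> Z0_inf"
        using Z0_inf_add[OF _ Z0_inf_uminus, of x m] x m Suc.prems(2) by (auto simp: N0_inf_def)
      ultimately show ?thesis
        unfolding pos_freq_def by blast
    qed (use m_min x in blast)
  qed (use m in blast)
qed

text \<open>
  A frequency in \<open>N0_inf\<close> below a given one has no non-zero entry after the last one of the given
  frequency, so the search for a minimum takes place in finitely many coordinates.
\<close>

lemma N0_inf_has_min:
  assumes "X \<noteq> {}" "X \<subseteq> N0_inf"
  shows "\<exists>m\<in>X. \<forall>x\<in>X. x = m \<or> (\<lambda>n. x n - m n) \<in> pos_freq"
proof -
  obtain x0 where x0: "x0 \<in> X" using assms by blast
  then have "finite {n. x0 n \<noteq> 0}" using assms by (auto simp: N0_inf_def Z0_inf_def)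
  then obtain N where N: "\<And>n. N \<le> n \<Longrightarrow> x0 n = 0"
    by (metis (mono_tags, lifting) finite_nat_set_iff_bounded mem_Collect_eq not_le)
  define X0 where "X0 = {x \<in> X. \<forall>n\<ge>N. x n = 0}"
  have "\<exists>m\<in>X0. \<forall>x\<in>X0. x = m \<or> (\<lambda>n. x n - m n) \<in> pos_freq"
    by (rule ex_min_agreeing_above[of X0 N]) (use x0 N assms in \<open>auto simp: X0_def\<close>)
  then obtain m where m: "m \<in> X0"
    and m_min: "\<And>x. x \<in> X0 \<Longrightarrow> x = m \<or> (\<lambda>n. x n - m n) \<in> pos_freq"
    by blast
  show ?thesis
  proof (intro bexI[of _ m] ballI)
    fix x assume x: "x \<in> X"
    show "x = m \<or> (\<lambda>n. x n - m n) \<in> pos_freq"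
    proof (cases "x \<in> X0")
      case False
      then obtain k where k: "N \<le> k" "x k \<noteq> 0" using x by (auto simp: X0_def)
      have xZ: "x \<in> Z0_inf" and mZ: "m \<in> Z0_inf" and nonneg: "\<And>n. 0 \<le> x n"
        using x m assms by (auto simp: X0_def N0_inf_def)
      obtain L where L: "k \<le> L" "x L \<noteq> 0" "\<And>n. n > L \<Longrightarrow> x n = 0"
        using top_index[OF xZ k(2)] by blast
      have "0 < x L - m L" "\<forall>n>L. x n - m n = 0"
        using L k m nonneg[of L] by (auto simp: X0_def)
      moreover have "(\<lambda>n. x n - m n) \<in> Z0_inf"
        using Z0_inf_add[OF xZ Z0_inf_uminus[OF mZ]] by simp
      ultimately show ?thesis
        unfolding pos_freq_def by blast
    qed (use m_min in blast)
  qed (use m X0_def in blast)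
qed

section \<open>Density of continuous functions for Borel measures on Polish spaces\<close>

text \<open>
  For an indicator function, outer regularity of the set and of its complement gives two open sets
  with small intersection that cover the space, and a Urysohn function switches from 1 to 0 on
  that intersection. Linearity and dominated convergence do the rest.
\<close>

lemma continuous_dense_L1:
  fixes u :: "'a::polish_space \<Rightarrow> real"
  assumes N: "finite_measure N" "sets N = sets borel" and "integrable N u" and "0 < e"
  shows "\<exists>v. continuous_on UNIV v \<and> integrable N v \<and> (\<integral>x. \<bar>u x - v x\<bar> \<partial>N) < e"
  using assms(3,4)
proof (induction u arbitrary: e rule: integrable_induct)
  case (base A c)
  interpret finite_measure N by fact
  \<comment> \<open>The Urysohn function misses the indicator on a set of measure below \<open>2 * d\<close>.\<close>
  define d where "d = e / (2 * (\<bar>c\<bar> + 1))"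
  have d: "0 < d" using base by (simp add: d_def)
  have A: "A \<in> sets borel" using base N by simp
  have "emeasure N A < emeasure N A + ennreal d"
    using base(2) d by (simp add: ennreal_add_left_cancel_less[of _ 0, simplified])
  then have "(INF U\<in>{U. A \<subseteq> U \<and> open U}. emeasure N U) < emeasure N A + ennreal d"
    using outer_regular[of N A] N A by simp
  then obtain U where U: "A \<subseteq> U" "open U" "emeasure N U < emeasure N A + ennreal d"
    by (auto simp: INF_less_iff)
  have "emeasure N (- A) < emeasure N (- A) + ennreal d"
    using d by (simp add: ennreal_add_left_cancel_less[of _ 0, simplified])
  then have "(INF U\<in>{U. - A \<subseteq> U \<and> open U}. emeasure N U) < emeasure N (- A) + ennreal d"
    using outer_regular[of N "- A"] N A by simp
  then obtain V where V: "- A \<subseteq> V" "open V" "emeasure N V < emeasure N (- A) + ennreal d"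
    by (auto simp: INF_less_iff)
  have meas [measurable]: "A \<in> sets N" "U \<in> sets N" "V \<in> sets N" "- A \<in> sets N"
    using A U V N by auto
  have mU: "measure N U < measure N A + d" 
    using U(3) d by (simp add: emeasure_eq_measure ennreal_less_iff flip: ennreal_plus)
  have mV: "measure N V < measure N (- A) + d" 
    using V(3) d by (simp add: emeasure_eq_measure ennreal_less_iff flip: ennreal_plus)
  have "measure N (U - A) < d" "measure N (V - (- A)) < d"
    using mU mV finite_measure_Diff[of U A] finite_measure_Diff[of V "- A"] U V by simp_all
  then have "measure N ((U - A) \<union> (V - (- A))) < 2 * d"
    using measure_Un_le[of "U - A" N "V - (- A)"] by auto
  moreover have "(U - A) \<union> (V - (- A)) = U \<inter> V" using U V by auto
  ultimately have mUV: "measure N (U \<inter> V) < 2 * d" by simp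
  have "normal_space (euclidean :: 'a topology)"
    by (intro metrizable_imp_normal_space metrizable_space_euclidean)
  then obtain f :: "'a \<Rightarrow> real" where f: "continuous_map euclidean (top_of_set {0..1}) f"
    "f ` (- U) \<subseteq> {0}" "f ` (- V) \<subseteq> {1}"
    using Urysohn_lemma[of euclidean "- U" "- V" 0 1] U V by (auto simp: disjnt_def)
  have cf: "continuous_on UNIV f" and f01: "\<And>x. 0 \<le> f x \<and> f x \<le> 1"
    using f(1) by (auto simp: continuous_map_in_subtopology)
  have [measurable]: "f \<in> borel_measurable N"
    using borel_measurable_continuous_onI[OF cf] N by (simp cong: measurable_cong_sets)
  have int: "integrable N (\<lambda>x. c * f x)"
    by (intro integrable_mult_right integrable_const_bound[where B = 1]) (use f01 in auto)
  have intUV: "integrable N (indicat_real (U \<inter> V))"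
    by (intro integrable_const_bound[where B = 1]) auto
  have "(\<integral>x. \<bar>indicator A x *\<^sub>R c - c * f x\<bar> \<partial>N) \<le> (\<integral>x. \<bar>c\<bar> * indicator (U \<inter> V) x \<partial>N)"
  proof (rule integral_mono)
    show "integrable N (\<lambda>x. \<bar>indicator A x *\<^sub>R c - c * f x\<bar>)"
      using int base(2) by (intro integrable_abs Bochner_Integration.integrable_diff) auto
    fix x
    have "\<bar>indicator A x - f x\<bar> \<le> indicator (U \<inter> V) x"
      using f f01[of x] U V by (auto simp: indicator_def image_subset_iff split: if_splits)
    then have "\<bar>c\<bar> * \<bar>indicator A x - f x\<bar> \<le> \<bar>c\<bar> * indicator (U \<inter> V) x"
      by (intro mult_left_mono) auto
    then show "\<bar>indicator A x *\<^sub>R c - c * f x\<bar> \<le> \<bar>c\<bar> * indicator (U \<inter> V) x"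
      by (simp add: algebra_simps flip: abs_mult)
  qed (use intUV in auto)
  also have "\<dots> = \<bar>c\<bar> * measure N (U \<inter> V)" by simp
  also have "\<dots> \<le> \<bar>c\<bar> * (2 * d)" using mUV by (intro mult_left_mono) auto
  also have "\<dots> < e" using base(3) by (simp add: d_def field_simps)
  finally show ?case
    using int cf by (intro exI[of _ "\<lambda>x. c * f x"]) (auto intro!: continuous_intros)
next
  case (add f g)
  obtain v w where v: "continuous_on UNIV v" "integrable N v" "(\<integral>x. \<bar>f x - v x\<bar> \<partial>N) < e / 2"
    and w: "continuous_on UNIV w" "integrable N w" "(\<integral>x. \<bar>g x - w x\<bar> \<partial>N) < e / 2"
    using add.IH(1,2)[of "e / 2"] add.prems by auto
  have "(\<integral>x. \<bar>f x + g x - (v x + w x)\<bar> \<partial>N) \<le> (\<integral>x. \<bar>f x - v x\<bar> + \<bar>g x - w x\<bar> \<partial>N)"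
    using add v w by (intro integral_mono) auto
  also have "\<dots> = (\<integral>x. \<bar>f x - v x\<bar> \<partial>N) + (\<integral>x. \<bar>g x - w x\<bar> \<partial>N)"
    using add v w by (intro Bochner_Integration.integral_add) auto
  also have "\<dots> < e" using v w by simp
  finally show ?case
    using v w by (intro exI[of _ "\<lambda>x. v x + w x"]) (auto intro!: continuous_intros)
next
  case (lim f s)
  have "(\<lambda>i. \<integral>x. \<bar>f x - s i x\<bar> \<partial>N) \<longlonglongrightarrow> (\<integral>x. 0 \<partial>N)"
  proof (rule integral_dominated_convergence[where w = "\<lambda>x. 3 * \<bar>f x\<bar>"])
    show "AE x in N. (\<lambda>i. \<bar>f x - s i x\<bar>) \<longlonglongrightarrow> 0"
    proof (intro AE_I2 tendsto_rabs_zero)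
      fix x assume "x \<in> space N"
      then show "(\<lambda>i. f x - s i x) \<longlonglongrightarrow> 0"
        using tendsto_diff[OF tendsto_const lim.hyps(2), of x "f x"] by simp
    qed
    \<comment> \<open>The approximating sequence of the induction rule satisfies \<open>|s i| \<le> 2 |f|\<close>.\<close>
    show "AE x in N. norm \<bar>f x - s i x\<bar> \<le> 3 * \<bar>f x\<bar>" for i
      using lim.hyps(3)[of _ i] by (intro AE_I2) fastforce
  qed (use lim in auto)
  then have "eventually (\<lambda>i. (\<integral>x. \<bar>f x - s i x\<bar> \<partial>N) < e / 2) sequentially"
    using lim.prems by (intro order_tendstoD) auto
  then obtain i where i: "(\<integral>x. \<bar>f x - s i x\<bar> \<partial>N) < e / 2"
    by (auto simp: eventually_sequentially)
  obtain v where v: "continuous_on UNIV v" "integrable N v" "(\<integral>x. \<bar>s i x - v x\<bar> \<partial>N) < e / 2"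
    using lim.IH[of "e / 2" i] lim.prems by auto
  have "(\<integral>x. \<bar>f x - v x\<bar> \<partial>N) \<le> (\<integral>x. \<bar>f x - s i x\<bar> + \<bar>s i x - v x\<bar> \<partial>N)"
    using lim v by (intro integral_mono) auto
  also have "\<dots> = (\<integral>x. \<bar>f x - s i x\<bar> \<partial>N) + (\<integral>x. \<bar>s i x - v x\<bar> \<partial>N)"
    using lim v by (intro Bochner_Integration.integral_add) auto
  also have "\<dots> < e" using v i by simp
  finally show ?case using v by blast
qed

section \<open>Topology and measure of the infinite torus\<close>

interpretation torus: prob_space torus_measure
  by (rule prob_space_torus_measure)

abbreviation torus :: "(nat \<Rightarrow> complex) set" where
  "torus \<equiv> space torus_measure"

lemma norm_torus_coord: "z \<in> torus \<Longrightarrow> norm (z n) = 1"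
  by (simp add: space_torus_measure)

lemma compact_torus: "compact torus"
proof -
  have "torus = PiE UNIV (\<lambda>_. sphere 0 1)"
    by (auto simp: space_torus_measure PiE_def Pi_def)
  moreover have "compactin (product_topology (\<lambda>_. euclidean) UNIV) (PiE UNIV (\<lambda>_::nat. sphere (0::complex) 1))"
    by (simp add: compactin_PiE)
  ultimately show ?thesis
    by (simp add: euclidean_product_topology)
qed

lemma torus_in_borel: "torus \<in> sets borel"
  using compact_torus by (simp add: borel_closed compact_imp_closed)

lemma id_measurable_torus_borel: "(\<lambda>z. z) \<in> measurable torus_measure borel"
proof -
  have "(\<lambda>z. z i) \<in> measurable torus_measure borel" for i
  proof -
    have "(\<lambda>x. x) \<in> measurable circle_measure borel"
      unfolding circle_measure_def by (simp add: measurable_restrict_space1)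
    moreover have "(\<lambda>z. z i) \<in> measurable torus_measure circle_measure"
      unfolding torus_measure_def by (rule measurable_component_singleton) simp
    ultimately show ?thesis
      by (rule measurable_compose_rev)
  qed
  then have "(\<lambda>z. z) \<in> measurable torus_measure (PiM UNIV (\<lambda>_. borel))"
    by (intro measurable_PiM_single') (auto simp: space_PiM)
  then show ?thesis
    using measurable_cong_sets[OF refl sets_PiM_equal_borel] by blast
qed

text \<open>
  The product of the circle's \<open>\<sigma>\<close>-algebras is the trace of the Borel \<open>\<sigma>\<close>-algebra of the product
  topology. This is what makes continuous functions on the torus measurable, and what lets
  regularity of Borel measures on a Polish space be applied to it.
\<close>

lemma sets_torus_measure: "sets torus_measure = sets (restrict_space borel torus)"
proof
  have id1: "(\<lambda>z. z) \<in> measurable (restrict_space borel torus) torus_measure"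
    unfolding torus_measure_def
  proof (rule measurable_PiM_single')
    fix i :: nat
    have "(\<lambda>z. z i) \<in> measurable (restrict_space borel torus) (restrict_space borel (sphere 0 1))"
      by (intro measurable_restrict_space2 measurable_restrict_space1)
         (auto simp: space_restrict_space space_torus_measure)
    then show "(\<lambda>z. z i) \<in> measurable (restrict_space borel (space (PiM UNIV (\<lambda>_. circle_measure)))) circle_measure"
      by (simp add: circle_measure_def torus_measure_def cong: measurable_cong_sets)
  qed (auto simp: space_restrict_space space_PiM)
  have "A \<in> sets (restrict_space borel torus)" if "A \<in> sets torus_measure" for A
  proof -
    have "(\<lambda>z. z) -` A \<inter> space (restrict_space borel torus) = A"
      using sets.sets_into_space[OF that] by (auto simp: space_restrict_space)
    then show ?thesis using measurable_sets[OF id1 that] by simp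
  qed
  then show "sets torus_measure \<subseteq> sets (restrict_space borel torus)"
    by blast
  have id2: "(\<lambda>z. z) \<in> measurable torus_measure (restrict_space borel torus)"
    using id_measurable_torus_borel by (intro measurable_restrict_space2) auto
  have "A \<in> sets torus_measure" if "A \<in> sets (restrict_space borel torus)" for A
  proof -
    have "(\<lambda>z. z) -` A \<inter> torus = A"
      using sets.sets_into_space[OF that] by (auto simp: space_restrict_space)
    then show ?thesis using measurable_sets[OF id2 that] by simp
  qed
  then show "sets (restrict_space borel torus) \<subseteq> sets torus_measure"
    by blast
qed

lemma continuous_on_torus_measurable:
  fixes v :: "_ \<Rightarrow> 'b::topological_space"
  assumes "continuous_on torus v"
  shows "v \<in> borel_measurable torus_measure"
  using borel_measurable_continuous_on_restrict[OF assms]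
  by (simp add: sets_torus_measure cong: measurable_cong_sets)

lemma integral_circle_powi:
  "(\<integral>z. z powi k \<partial>circle_measure) = (if k = 0 then 1 else 0)"
proof (cases "k = 0")
  case True
  then show ?thesis
    using prob_space.prob_space[OF prob_space_circle_measure] by simp
next
  case False
  have "continuous_on (sphere 0 1) (\<lambda>z::complex. z powi k)"
    by (intro continuous_intros) auto
  then have "(\<integral>z. z powi k \<partial>circle_measure) = 
      (\<integral>t. cis t powi k \<partial>uniform_measure lborel {0..2 * pi})"
    unfolding circle_measure_def
    by (intro integral_distr borel_measurable_continuous_on_restrict)
       (use measurable_cis_circle in \<open>simp_all cong: measurable_cong_sets\<close>)
  also have "uniform_measure lborel {0..2 * pi} = 
      density lborel (\<lambda>t. ennreal (indicator {0..2 * pi} t / (2 * pi)))"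
    unfolding uniform_measure_def
    by (intro density_cong) (auto simp: indicator_def divide_ennreal simp flip: ennreal_1)
  also have "(\<integral>t. cis t powi k \<partial>density lborel (\<lambda>t. ennreal (indicator {0..2 * pi} t / (2 * pi)))) = 
      (\<integral>t. (indicator {0..2 * pi} t / (2 * pi)) *\<^sub>R cis (of_int k * t) \<partial>lborel)"
    by (subst integral_density) (auto simp: cis_power_int intro!: borel_measurable_continuous_onI continuous_intros)
  also have "\<dots> = (\<integral>t. (1 / (2 * pi)) *\<^sub>R (indicator {0..2 * pi} t *\<^sub>R cis (of_int k * t)) \<partial>lborel)"
    by (intro Bochner_Integration.integral_cong) auto
  also have "\<dots> = (1 / (2 * pi)) *\<^sub>R (\<integral>t. indicator {0..2 * pi} t *\<^sub>R cis (of_int k * t) \<partial>lborel)"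
    by (rule integral_scaleR_right) 
  also have "(\<integral>t. indicator {0..2 * pi} t *\<^sub>R cis (of_int k * t) \<partial>lborel) = 
     cis (of_int k * (2 * pi)) / (\<i> * of_int k) - cis (of_int k * 0) / (\<i> * of_int k)"
  proof (rule has_bochner_integral_integral_eq, rule has_bochner_integral_FTC_Icc)
    fix t :: real
    show "((\<lambda>t. cis (of_int k * t) / (\<i> * of_int k)) has_vector_derivative cis (of_int k * t))
        (at t within {0..2 * pi})"
      unfolding has_vector_derivative_def using False
      by (auto intro!: derivative_eq_intros simp: fun_eq_iff scaleR_conv_of_real field_simps)
  qed (auto intro!: continuous_intros)
  also have "cis (of_int k * (2 * pi)) = 1"
    using cis_multiple_2pi[of "of_int k"] by (simp add: mult_ac)
  finally show ?thesis using False by simp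
qed

section \<open>Characters\<close>

definition character :: "(nat \<Rightarrow> int) \<Rightarrow> (nat \<Rightarrow> complex) \<Rightarrow> complex" where
  "character \<nu> z = (\<Prod>n | \<nu> n \<noteq> 0. z n powi \<nu> n)"

lemma character_superset:
  assumes "finite F" "{n. \<nu> n \<noteq> 0} \<subseteq> F"
  shows "character \<nu> z = (\<Prod>n\<in>F. z n powi \<nu> n)"
  unfolding character_def using assms by (intro prod.mono_neutral_left) auto

lemma character_0: "character (\<lambda>_. 0) z = 1"
  by (simp add: character_def)

lemma character_add:
  assumes "\<nu> \<in> Z0_inf" "\<mu> \<in> Z0_inf" "z \<in> torus"
  shows "character (\<lambda>n. \<nu> n + \<mu> n) z = character \<nu> z * character \<mu> z"
proof -
  define F where "F = {n. \<nu> n \<noteq> 0} \<union> {n. \<mu> n \<noteq> 0}"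
  have F: "finite F" using assms by (auto simp: F_def Z0_inf_def)
  have nz: "z n \<noteq> 0" for n using norm_torus_coord[OF assms(3), of n] by auto
  have "character (\<lambda>n. \<nu> n + \<mu> n) z = (\<Prod>n\<in>F. z n powi (\<nu> n + \<mu> n))"
    using F by (intro character_superset) (auto simp: F_def)
  also have "\<dots> = (\<Prod>n\<in>F. z n powi \<nu> n) * (\<Prod>n\<in>F. z n powi \<mu> n)"
    using nz by (simp add: power_int_add prod.distrib)
  also have "\<dots> = character \<nu> z * character \<mu> z"
    using F by (subst (1 2) character_superset[of F]) (auto simp: F_def)
  finally show ?thesis .
qed

lemma norm_character: "z \<in> torus \<Longrightarrow> norm (character \<nu> z) = 1"
  by (simp add: character_def norm_power_int norm_torus_coord flip: prod_norm)

lemma character_uminus: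
  assumes "z \<in> torus"
  shows "character (\<lambda>n. - \<nu> n) z = cnj (character \<nu> z)"
proof -
  have "z n powi (- \<nu> n) = cnj (z n powi \<nu> n)" for n
  proof -
    have "norm (z n powi \<nu> n) = 1"
      using norm_torus_coord[OF assms] by (simp add: norm_power_int)
    then have "z n powi \<nu> n * cnj (z n powi \<nu> n) = 1"
      by (simp add: complex_norm_square[symmetric] del: complex_cnj_power_int)
    then show ?thesis
      unfolding power_int_minus by (rule inverse_unique)
  qed
  then show ?thesis
    by (simp add: character_def del: complex_cnj_power_int)
qed

lemma continuous_on_character: "continuous_on torus (character \<nu>)"
proof -
  have "z n \<noteq> 0" if "z \<in> torus" for z n
    using norm_torus_coord[OF that, of n] by auto
  then have "continuous_on torus (\<lambda>z. z n powi \<nu> n)" for n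
    by (intro continuous_on_power_int continuous_on_subset[OF continuous_on_product_coordinates]) auto
  then show ?thesis
    unfolding character_def by (intro continuous_on_prod)
qed

lemma character_measurable [measurable]: "character \<nu> \<in> borel_measurable torus_measure"
  by (intro continuous_on_torus_measurable continuous_on_character)

text \<open>
  A character depends on finitely many coordinates, so its integral is a finite product of
  integrals over the circle.
\<close>

lemma integral_character:
  assumes "\<nu> \<in> Z0_inf"
  shows "(\<integral>z. character \<nu> z \<partial>torus_measure) = (if \<nu> = (\<lambda>_. 0) then 1 else 0)"
proof -
  define J where "J = {n. \<nu> n \<noteq> 0}"
  have J: "finite J" using assms by (simp add: J_def Z0_inf_def)
  interpret product_prob_space "\<lambda>_::nat. circle_measure" UNIV
    by (intro product_prob_spaceI prob_space_circle_measure)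
  have [measurable]: "(\<lambda>w. w powi k) \<in> borel_measurable circle_measure" for k
  proof -
    have "(\<lambda>w::complex. w powi k) \<in> borel_measurable (restrict_space borel (sphere 0 1))"
      by (intro borel_measurable_continuous_on_restrict continuous_intros) auto
    then show ?thesis by (simp add: circle_measure_def cong: measurable_cong_sets)
  qed
  have int: "integrable circle_measure (\<lambda>w. w powi k)" for k
    by (intro finite_measure.integrable_const_bound[where B = 1] prob_space.finite_measure
          prob_space_circle_measure AE_I2)
       (simp_all add: space_circle_measure norm_power_int)
  have "(\<integral>z. character \<nu> z \<partial>torus_measure) = 
      (\<integral>z. (\<Prod>n\<in>J. restrict z J n powi \<nu> n) \<partial>torus_measure)"
    by (intro Bochner_Integration.integral_cong) (simp_all add: character_def J_def)
  also have "\<dots> = (\<integral>z. (\<Prod>n\<in>J. z n powi \<nu> n) \<partial>distr torus_measure (PiM J (\<lambda>_. circle_measure)) (\<lambda>z. restrict z J))"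
    unfolding torus_measure_def
  proof (rule integral_distr[symmetric])
    have "(\<lambda>z. z n powi \<nu> n) \<in> borel_measurable (PiM J (\<lambda>_. circle_measure))" if "n \<in> J" for n
      using that by (intro measurable_compose[OF measurable_component_singleton]) auto
    then show "(\<lambda>z. \<Prod>n\<in>J. z n powi \<nu> n) \<in> borel_measurable (PiM J (\<lambda>_. circle_measure))"
      by (rule borel_measurable_prod)
  qed (rule measurable_restrict_subset[OF subset_UNIV])
  also have "\<dots> = (\<integral>z. (\<Prod>n\<in>J. z n powi \<nu> n) \<partial>PiM J (\<lambda>_. circle_measure))"
    using J by (simp add: torus_measure_def distr_PiM_restrict_finite)
  also have "\<dots> = (\<Prod>n\<in>J. (\<integral>w. w powi \<nu> n \<partial>circle_measure))"
    using J int by (intro product_integral_prod) auto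
  also have "\<dots> = (if \<nu> = (\<lambda>_. 0) then 1 else 0)"
    using J by (auto simp: integral_circle_powi J_def)
  finally show ?thesis .
qed

lemma fourier_coeff_character: 
  "fourier_coeff f \<nu> = (\<integral>z. f z * character (\<lambda>n. - \<nu> n) z \<partial>torus_measure)"
  by (simp add: fourier_coeff_def character_def)

section \<open>Trigonometric polynomials and their density\<close>

text \<open>
  Membership is membership as functions on the whole type, whereas the multiplication rule for
  characters holds on the torus only. Closure under products is therefore stated up to equality on
  the torus.
\<close>

inductive_set trig_poly :: "(nat \<Rightarrow> int) set \<Rightarrow> ((nat \<Rightarrow> complex) \<Rightarrow> complex) set"
  for A where
  zero: "(\<lambda>_. 0) \<in> trig_poly A"
| add_character: "p \<in> trig_poly A \<Longrightarrow> \<nu> \<in> A \<Longrightarrow> (\<lambda>z. p z + c * character \<nu> z) \<in> trig_poly A"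

lemma trig_poly_monomial: "\<nu> \<in> A \<Longrightarrow> (\<lambda>z. c * character \<nu> z) \<in> trig_poly A"
  using trig_poly.add_character[OF trig_poly.zero, of \<nu> A c] by simp

lemma trig_poly_const: "(\<lambda>_. c) \<in> trig_poly Z0_inf"
  using trig_poly_monomial[OF Z0_inf_0, of c] by (simp add: character_0)

lemma trig_poly_add:
  assumes "p \<in> trig_poly A" "q \<in> trig_poly A"
  shows "(\<lambda>z. p z + q z) \<in> trig_poly A"
  using assms(2)
proof induction
  case (add_character q \<nu> c)
  then show ?case
    using trig_poly.add_character[of "\<lambda>z. p z + q z" A \<nu> c] by (simp add: add.assoc)
qed (use assms in simp)

lemma continuous_on_trig_poly: "p \<in> trig_poly A \<Longrightarrow> continuous_on torus p"
  by (induction rule: trig_poly.induct) (auto intro!: continuous_intros continuous_on_character)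

lemma trig_poly_bounded: 
  assumes "p \<in> trig_poly A"
  obtains B where "0 \<le> B" "\<And>z. z \<in> torus \<Longrightarrow> norm (p z) \<le> B"
proof -
  have "compact (p ` torus)"
    using continuous_on_trig_poly[OF assms] compact_torus by (rule compact_continuous_image)
  then obtain B where B: "\<forall>w\<in>p ` torus. norm w \<le> B"
    using compact_imp_bounded bounded_iff by metis
  then show thesis by (intro that[of "max 0 B"]) (auto simp: max.coboundedI2)
qed

lemma trig_poly_mult_character:
  assumes "p \<in> trig_poly A" "\<nu> \<in> A" "A \<subseteq> Z0_inf"
    and closed: "\<And>\<nu> \<mu>. \<nu> \<in> A \<Longrightarrow> \<mu> \<in> A \<Longrightarrow> (\<lambda>n. \<nu> n + \<mu> n) \<in> A"
  shows "\<exists>r\<in>trig_poly A. \<forall>z\<in>torus. r z = p z * (c * character \<nu> z)"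
  using assms(1)
proof induction
  case zero
  then show ?case using trig_poly.zero by force
next
  case (add_character p \<mu> d)
  then obtain r where r: "r \<in> trig_poly A" "\<And>z. z \<in> torus \<Longrightarrow> r z = p z * (c * character \<nu> z)"
    by blast
  have "(\<lambda>z. r z + c * d * character (\<lambda>n. \<mu> n + \<nu> n) z) \<in> trig_poly A"
    using r add_character assms closed by (intro trig_poly.add_character) auto
  moreover have "r z + c * d * character (\<lambda>n. \<mu> n + \<nu> n) z = (p z + d * character \<mu> z) * (c * character \<nu> z)"
    if "z \<in> torus" for z
    using character_add[of \<mu> \<nu> z] that add_character assms r by (simp add: subset_iff algebra_simps)
  ultimately show ?case by (intro bexI ballI)
qed

lemma trig_poly_mult:
  assumes "p \<in> trig_poly A" "q \<in> trig_poly A" "A \<subseteq> Z0_inf"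
    and closed: "\<And>\<nu> \<mu>. \<nu> \<in> A \<Longrightarrow> \<mu> \<in> A \<Longrightarrow> (\<lambda>n. \<nu> n + \<mu> n) \<in> A"
  shows "\<exists>r\<in>trig_poly A. \<forall>z\<in>torus. r z = p z * q z"
  using assms(2)
proof induction
  case zero
  then show ?case using trig_poly.zero by force
next
  case (add_character q \<mu> d)
  obtain r where r: "r \<in> trig_poly A" "\<And>z. z \<in> torus \<Longrightarrow> r z = p z * q z"
    using add_character.IH by blast
  obtain s where s: "s \<in> trig_poly A" "\<And>z. z \<in> torus \<Longrightarrow> s z = p z * (d * character \<mu> z)"
    using trig_poly_mult_character[OF assms(1) add_character.hyps(2) assms(3) closed] by blast
  show ?case
    by (rule bexI[OF _ trig_poly_add[OF r(1) s(1)]]) (simp add: r(2) s(2) distrib_left)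
qed

lemma trig_poly_power:
  assumes "q \<in> trig_poly pos_freq"
  shows "\<exists>r\<in>trig_poly pos_freq. \<forall>z\<in>torus. r z = q z ^ Suc k"
proof (induction k)
  case 0
  then show ?case using assms by auto
next
  case (Suc k)
  then obtain r where r: "r \<in> trig_poly pos_freq" "\<And>z. z \<in> torus \<Longrightarrow> r z = q z ^ Suc k"
    by blast
  obtain s where "s \<in> trig_poly pos_freq" "\<And>z. z \<in> torus \<Longrightarrow> s z = q z * r z"
    using trig_poly_mult[OF assms r(1) pos_freq_subset pos_freq_add] by blast
  then show ?case
    using r(2) by (intro bexI[of _ s]) simp_all
qed

definition real_trig_poly :: "((nat \<Rightarrow> complex) \<Rightarrow> real) \<Rightarrow> bool" where
  "real_trig_poly u \<longleftrightarrow> (\<exists>p\<in>trig_poly Z0_inf. \<forall>z\<in>torus. of_real (u z) = p z)"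

lemma continuous_on_real_trig_poly:
  assumes "real_trig_poly u"
  shows "continuous_on torus u"
proof -
  obtain p where p: "p \<in> trig_poly Z0_inf" "\<And>z. z \<in> torus \<Longrightarrow> of_real (u z) = p z"
    using assms by (auto simp: real_trig_poly_def)
  have "continuous_on torus (\<lambda>z. Re (p z))"
    using continuous_on_trig_poly[OF p(1)] by (intro continuous_intros)
  moreover have "u z = Re (p z)" if "z \<in> torus" for z
    using p(2)[OF that] by (metis Re_complex_of_real)
  ultimately show ?thesis by (simp cong: continuous_on_cong)
qed

text \<open>
  Stone--Weierstrass: the real and imaginary parts of the coordinates separate points.
\<close>

lemma real_trig_poly_dense:
  assumes "continuous_on torus v" "0 < e"
  shows "\<exists>u. real_trig_poly u \<and> (\<forall>z\<in>torus. \<bar>v z - u z\<bar> < e)"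
proof (rule Stone_Weierstrass_HOL[OF compact_torus _ _ _ _ _ assms])
  show "real_trig_poly (\<lambda>_. c)" for c
    unfolding real_trig_poly_def using trig_poly_const by auto
  show "continuous_on torus u" if "real_trig_poly u" for u
    using that by (rule continuous_on_real_trig_poly)
  show "real_trig_poly (\<lambda>z. u z + v z)" if uv: "real_trig_poly u \<and> real_trig_poly v" for u v
  proof -
    obtain p q where p: "p \<in> trig_poly Z0_inf" "\<And>z. z \<in> torus \<Longrightarrow> of_real (u z) = p z" and
      q: "q \<in> trig_poly Z0_inf" "\<And>z. z \<in> torus \<Longrightarrow> of_real (v z) = q z"
      using uv unfolding real_trig_poly_def by blast
    then show ?thesis
      unfolding real_trig_poly_def by (intro bexI[OF _ trig_poly_add[OF p(1) q(1)]]) simp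
  qed
  show "real_trig_poly (\<lambda>z. u z * v z)" if uv: "real_trig_poly u \<and> real_trig_poly v" for u v
  proof -
    obtain p q where p: "p \<in> trig_poly Z0_inf" "\<And>z. z \<in> torus \<Longrightarrow> of_real (u z) = p z" and
      q: "q \<in> trig_poly Z0_inf" "\<And>z. z \<in> torus \<Longrightarrow> of_real (v z) = q z"
      using uv unfolding real_trig_poly_def by blast
    obtain r where "r \<in> trig_poly Z0_inf" "\<And>z. z \<in> torus \<Longrightarrow> r z = p z * q z"
      using trig_poly_mult[OF p(1) q(1) order_refl Z0_inf_add] by blast
    then show ?thesis
      unfolding real_trig_poly_def using p(2) q(2) by (intro bexI[of _ r]) simp_all
  qed
  fix x y assume xy: "x \<in> torus \<and> y \<in> torus \<and> x \<noteq> y"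
  then obtain n where n: "x n \<noteq> y n" by blast
  define \<epsilon> :: "nat \<Rightarrow> int" where "\<epsilon> = (\<lambda>m. if m = n then 1 else 0)"
  have \<epsilon>: "\<epsilon> \<in> Z0_inf" by (simp add: \<epsilon>_def Z0_inf_def)
  have char: "character \<epsilon> z = z n" for z
    by (subst character_superset[of "{n}"]) (auto simp: \<epsilon>_def)
  have real: "real_trig_poly (\<lambda>z. Re (c * z n))" for c
    unfolding real_trig_poly_def
  proof (rule bexI)
    show "\<forall>z\<in>torus. complex_of_real (Re (c * z n)) = 
        c / 2 * character \<epsilon> z + cnj c / 2 * character (\<lambda>n. - \<epsilon> n) z"
      by (simp add: character_uminus char complex_eq_iff field_simps)
    show "(\<lambda>z. c / 2 * character \<epsilon> z + cnj c / 2 * character (\<lambda>n. - \<epsilon> n) z) \<in> trig_poly Z0_inf"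
      using \<epsilon> by (intro trig_poly_add trig_poly_monomial Z0_inf_uminus)
  qed
  \<comment> \<open>Multiplication by \<open>\<i>\<close> turns the real part into minus the imaginary part.\<close>
  have "Re (1 * x n) \<noteq> Re (1 * y n) \<or> Re (\<i> * x n) \<noteq> Re (\<i> * y n)"
    using n by (auto simp: complex_eq_iff)
  then show "\<exists>f. real_trig_poly f \<and> f x \<noteq> f y"
    using real by blast
qed

text \<open>
  Approximation in the weighted space with density \<open>1 + w\<close>, where \<open>w\<close> will be \<open>|g|\<close>: it controls
  \<open>\<integral> u\<close> and integrals of \<open>u\<close> against \<open>g\<close> at the same time. The uniform bound on the
  approximants is needed because they will be exponentiated. It is obtained by clamping a
  continuous approximant to \<open>[-C, C]\<close>, which only brings it closer to \<open>u\<close>, and then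
  approximating the clamped function uniformly.
\<close>

lemma real_trig_poly_dense_L1:
  assumes w: "integrable torus_measure w" "\<And>z. z \<in> torus \<Longrightarrow> 0 \<le> w z"
    and u [measurable]: "u \<in> borel_measurable torus_measure"
    and C: "\<And>z. z \<in> torus \<Longrightarrow> \<bar>u z\<bar> \<le> C" and e: "0 < e"
  shows "\<exists>v. real_trig_poly v \<and> (\<forall>z\<in>torus. \<bar>v z\<bar> \<le> C + e) \<and> 
    (\<integral>z. \<bar>u z - v z\<bar> * (1 + w z) \<partial>torus_measure) < e"
proof -
  define I where "I = (\<integral>z. 1 + w z \<partial>torus_measure)"
  have I: "0 \<le> I" unfolding I_def using w(2) by (intro integral_nonneg_AE) auto
  define d where "d = e / (2 * (I + 1))"
  have d: "0 < d" "d \<le> e" "d * I < e / 2" 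
    using e I by (auto simp: d_def field_simps intro: add_pos_nonneg)
  have [measurable]: "w \<in> borel_measurable torus_measure" using w by auto
  define M where "M = density torus_measure (\<lambda>z. ennreal (1 + w z))"
  have fM: "finite_measure M"
  proof
    have "emeasure M (space M) = (\<integral>\<^sup>+z. ennreal (1 + w z) \<partial>torus_measure)"
      unfolding M_def by (subst emeasure_density) (auto intro!: nn_integral_cong)
    also have "\<dots> = ennreal I"
      unfolding I_def using w by (intro nn_integral_eq_integral) auto
    finally show "emeasure M (space M) \<noteq> \<infinity>" by simp
  qed
  have idM [measurable]: "(\<lambda>z. z) \<in> measurable M borel"
    using id_measurable_torus_borel by (simp add: M_def)
  define N where "N = distr M borel (\<lambda>z. z)"
  have fN: "finite_measure N" "sets N = sets borel"
    using finite_measure.finite_measure_distr[OF fM idM] by (simp_all add: N_def)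
  have C0: "0 \<le> C"
    using C torus.not_empty by (meson abs_ge_zero all_not_in_conv order_trans)
  \<comment> \<open>The density theorem lives on the whole space of sequences, so the weighted measure is pushed
    forward there and \<open>u\<close> is extended by 0.\<close>
  define u' where "u' = (\<lambda>z. if z \<in> torus then u z else 0)"
  have u': "u' \<in> borel_measurable borel"
  proof -
    have "u \<in> borel_measurable (restrict_space borel torus)"
      using u by (simp add: sets_torus_measure cong: measurable_cong_sets)
    then show ?thesis
      unfolding u'_def using torus_in_borel
      by (subst (asm) measurable_restrict_space_iff[where c = 0]) auto
  qed
  then have [measurable]: "u' \<in> borel_measurable N"
    using fN(2) by (simp cong: measurable_cong_sets)
  interpret N: finite_measure N by (rule fN)
  have "integrable N u'"
  proof (rule N.integrable_const_bound[where B = C])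
    show "AE x in N. norm (u' x) \<le> C"
      using C C0 by (simp add: u'_def)
  qed simp
  then obtain v where v: "continuous_on UNIV v" "integrable N v" "(\<integral>x. \<bar>u' x - v x\<bar> \<partial>N) < e / 2"
    using continuous_dense_L1[OF fN, of u' "e / 2"] e by auto
  have vb: "v \<in> borel_measurable borel"
    using v(1) by (rule borel_measurable_continuous_onI)
  have cont_v: "continuous_on torus v" using v(1) continuous_on_subset by blast
  then have [measurable]: "v \<in> borel_measurable torus_measure"
    by (rule continuous_on_torus_measurable)
  have eqN: "(\<integral>x. \<bar>u' x - v x\<bar> \<partial>N) = (\<integral>z. \<bar>u z - v z\<bar> * (1 + w z) \<partial>torus_measure)"
  proof -
    have "(\<integral>x. \<bar>u' x - v x\<bar> \<partial>N) = (\<integral>x. \<bar>u' x - v x\<bar> \<partial>M)"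
      unfolding N_def using u' vb by (intro integral_distr) auto
    also have "\<dots> = (\<integral>x. \<bar>u x - v x\<bar> \<partial>M)"
      by (intro Bochner_Integration.integral_cong) (auto simp: u'_def M_def)
    also have "\<dots> = (\<integral>z. (1 + w z) *\<^sub>R \<bar>u z - v z\<bar> \<partial>torus_measure)"
      unfolding M_def using w by (intro integral_density) auto
    finally show ?thesis by (simp add: mult.commute)
  qed
  define v' where "v' = (\<lambda>z. max (- C) (min C (v z)))"
  have v'C: "\<bar>v' z\<bar> \<le> C" for z using C0 by (auto simp: v'_def)
  have "continuous_on torus v'"
    unfolding v'_def using cont_v by (intro continuous_intros)
  then obtain t where t: "real_trig_poly t" "\<And>z. z \<in> torus \<Longrightarrow> \<bar>v' z - t z\<bar> < d"
    using real_trig_poly_dense d(1) by metis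
  have [measurable]: "t \<in> borel_measurable torus_measure" "v' \<in> borel_measurable torus_measure"
    using continuous_on_real_trig_poly[OF t(1)] by (auto intro: continuous_on_torus_measurable simp: v'_def)
  have intw: "integrable torus_measure (\<lambda>z. (2 * C) * (1 + w z))"
    using w by auto
  have int1: "integrable torus_measure (\<lambda>z. \<bar>u z - v' z\<bar> * (1 + w z))"
  proof (rule Bochner_Integration.integrable_bound[OF intw])
    have "\<bar>u z - v' z\<bar> * (1 + w z) \<le> (2 * C) * (1 + w z)" if "z \<in> torus" for z
      using C[OF that] v'C[of z] w(2)[OF that] by (intro mult_right_mono) linarith+
    then show "AE z in torus_measure. norm (\<bar>u z - v' z\<bar> * (1 + w z)) \<le> norm ((2 * C) * (1 + w z))"
      using w(2) C0 by (intro AE_I2) (fastforce simp: abs_mult)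
  qed auto
  have "(\<integral>z. \<bar>u z - v' z\<bar> * (1 + w z) \<partial>torus_measure) \<le> (\<integral>z. \<bar>u z - v z\<bar> * (1 + w z) \<partial>torus_measure)"
  proof (rule integral_mono[OF int1])
    have "integrable N (\<lambda>x. \<bar>u' x - v x\<bar>)" using \<open>integrable N u'\<close> v(2) by auto
    then have "integrable M (\<lambda>x. \<bar>u' x - v x\<bar>)"
      unfolding N_def using u' vb by (subst (asm) integrable_distr_eq) auto
    then have "integrable M (\<lambda>x. \<bar>u x - v x\<bar>)"
      by (subst (asm) Bochner_Integration.integrable_cong[OF refl, of _ _ "\<lambda>x. \<bar>u x - v x\<bar>"]) (auto simp: u'_def M_def)
    then have "integrable torus_measure (\<lambda>z. (1 + w z) *\<^sub>R \<bar>u z - v z\<bar>)"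
      unfolding M_def using w by (subst (asm) integrable_density) auto
    then show "integrable torus_measure (\<lambda>z. \<bar>u z - v z\<bar> * (1 + w z))"
      by (simp add: mult.commute)
    fix z assume z: "z \<in> torus"
    have "\<bar>u z - v' z\<bar> \<le> \<bar>u z - v z\<bar>"
      using C[OF z] by (auto simp: v'_def)
    then show "\<bar>u z - v' z\<bar> * (1 + w z) \<le> \<bar>u z - v z\<bar> * (1 + w z)"
      using w(2)[OF z] by (intro mult_right_mono) auto
  qed
  also have "\<dots> < e / 2" using v(3) eqN by simp
  finally have *: "(\<integral>z. \<bar>u z - v' z\<bar> * (1 + w z) \<partial>torus_measure) < e / 2" .
  have tb: "\<bar>t z\<bar> \<le> C + e" if "z \<in> torus" for z
    using t(2)[OF that] v'C[of z] d(2) by linarith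
  have "(\<integral>z. \<bar>u z - t z\<bar> * (1 + w z) \<partial>torus_measure) \<le> 
      (\<integral>z. \<bar>u z - v' z\<bar> * (1 + w z) + d * (1 + w z) \<partial>torus_measure)"
  proof (rule integral_mono')
    show "integrable torus_measure (\<lambda>z. \<bar>u z - v' z\<bar> * (1 + w z) + d * (1 + w z))"
      using int1 w by auto
    fix z assume z: "z \<in> torus"
    have "\<bar>u z - t z\<bar> \<le> \<bar>u z - v' z\<bar> + d" using t(2)[OF z] by linarith
    then have "\<bar>u z - t z\<bar> * (1 + w z) \<le> (\<bar>u z - v' z\<bar> + d) * (1 + w z)"
      using w(2)[OF z] by (intro mult_right_mono) auto
    then show "\<bar>u z - t z\<bar> * (1 + w z) \<le> \<bar>u z - v' z\<bar> * (1 + w z) + d * (1 + w z)"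
      by (simp add: distrib_right)
    show "0 \<le> \<bar>u z - v' z\<bar> * (1 + w z) + d * (1 + w z)" 
      using w(2)[OF z] d(1) by auto
  qed
  also have "\<dots> = (\<integral>z. \<bar>u z - v' z\<bar> * (1 + w z) \<partial>torus_measure) + d * I"
    unfolding I_def using int1 w by (subst Bochner_Integration.integral_add) auto
  also have "\<dots> < e" using * d(3) by simp
  finally show ?thesis using t(1) tb by blast
qed

section \<open>Uniqueness of Fourier coefficients\<close>

lemma integrable_times_bounded:
  assumes "integrable torus_measure g" "h \<in> borel_measurable torus_measure"
    and "\<And>z. z \<in> torus \<Longrightarrow> norm (h z) \<le> B"
  shows "integrable torus_measure (\<lambda>z. g z * h z :: complex)"
proof (rule Bochner_Integration.integrable_bound)
  show "integrable torus_measure (\<lambda>z. B * norm (g z))"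
    using assms by simp
  have "norm (g z * h z) \<le> norm (B * norm (g z))" if "z \<in> torus" for z
    using mult_left_mono[OF assms(3)[OF that] norm_ge_zero[of "g z"]] 
    by (simp add: norm_mult mult.commute)
  then show "AE z in torus_measure. norm (g z * h z) \<le> norm (B * norm (g z))"
    by (intro AE_I2)
qed (use assms in auto)

lemma integrable_times_trig_poly:
  assumes "integrable torus_measure g" "p \<in> trig_poly A"
  shows "integrable torus_measure (\<lambda>z. g z * p z)"
  using trig_poly_bounded[OF assms(2)] integrable_times_bounded[OF assms(1)]
    continuous_on_torus_measurable[OF continuous_on_trig_poly[OF assms(2)]] by metis

lemma integral_times_trig_poly_eq_0:
  assumes "integrable torus_measure g" "p \<in> trig_poly A"
    and "\<And>\<nu>. \<nu> \<in> A \<Longrightarrow> (\<integral>z. g z * character \<nu> z \<partial>torus_measure) = 0"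
  shows "(\<integral>z. g z * p z \<partial>torus_measure) = 0"
  using assms(2)
proof induction
  case (add_character p \<nu> c)
  have "integrable torus_measure (\<lambda>z. c * (g z * character \<nu> z))"
    using norm_character
    by (intro integrable_mult_right integrable_times_bounded[OF assms(1), where B = 1]) auto
  moreover have "integrable torus_measure (\<lambda>z. g z * p z)"
    using assms(1) add_character by (intro integrable_times_trig_poly)
  ultimately have "(\<integral>z. g z * p z + c * (g z * character \<nu> z) \<partial>torus_measure) = 0"
    using add_character assms(3) by simp
  then show ?case by (simp add: algebra_simps)
qed simp

text \<open>
  Annihilating all trigonometric polynomials implies annihilating all bounded functions, by weighted
  density.
\<close>

lemma integral_eq_0_of_fourier_coeffs_0:
  assumes g: "integrable torus_measure g"
    and vanish: "\<And>\<nu>. \<nu> \<in> Z0_inf \<Longrightarrow> (\<integral>z. g z * character \<nu> z \<partial>torus_measure) = 0"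
    and u: "u \<in> borel_measurable torus_measure" "\<And>z. z \<in> torus \<Longrightarrow> \<bar>u z\<bar> \<le> 1"
  shows "(\<integral>z. g z * of_real (u z) \<partial>torus_measure) = 0"
proof -
  have "norm (\<integral>z. g z * of_real (u z) \<partial>torus_measure) \<le> e" if e: "0 < e" for e
  proof -
    obtain v where v: "real_trig_poly v" "\<And>z. z \<in> torus \<Longrightarrow> \<bar>v z\<bar> \<le> 1 + e"
      "(\<integral>z. \<bar>u z - v z\<bar> * (1 + norm (g z)) \<partial>torus_measure) < e"
      using real_trig_poly_dense_L1[of "\<lambda>z. norm (g z)" u 1 e] g u e by auto
    obtain p where p: "p \<in> trig_poly Z0_inf" "\<And>z. z \<in> torus \<Longrightarrow> of_real (v z) = p z"
      using v(1) by (auto simp: real_trig_poly_def)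
    have [measurable]: "v \<in> borel_measurable torus_measure"
      by (intro continuous_on_torus_measurable continuous_on_real_trig_poly v)
    have i1: "integrable torus_measure (\<lambda>z. g z * of_real (u z))"
      using u by (intro integrable_times_bounded[OF g, where B = 1]) auto
    have i2: "integrable torus_measure (\<lambda>z. g z * of_real (v z))"
      using v(2) by (intro integrable_times_bounded[OF g, where B = "1 + e"]) auto
    have "(\<integral>z. g z * of_real (v z) \<partial>torus_measure) = (\<integral>z. g z * p z \<partial>torus_measure)"
      using p(2) by (intro Bochner_Integration.integral_cong) auto
    also have "\<dots> = 0"
      using g p(1) vanish by (rule integral_times_trig_poly_eq_0)
    finally have "(\<integral>z. g z * of_real (u z) \<partial>torus_measure) = 
        (\<integral>z. g z * of_real (u z) - g z * of_real (v z) \<partial>torus_measure)"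
      using i1 i2 by simp
    also have "norm \<dots> \<le> (\<integral>z. norm (g z * of_real (u z) - g z * of_real (v z)) \<partial>torus_measure)"
      by (rule integral_norm_bound)
    also have "\<dots> \<le> (\<integral>z. \<bar>u z - v z\<bar> * (1 + norm (g z)) \<partial>torus_measure)"
    proof (rule integral_mono)
      show "integrable torus_measure (\<lambda>z. norm (g z * of_real (u z) - g z * of_real (v z)))"
        using i1 i2 by auto
      have "integrable torus_measure (\<lambda>z. \<bar>u z - v z\<bar> + norm (g z * of_real (u z) - g z * of_real (v z)))"
      proof (intro Bochner_Integration.integrable_add)
        show "integrable torus_measure (\<lambda>z. \<bar>u z - v z\<bar>)"
          using u v(2) 
          by (intro torus.integrable_const_bound[where B = "2 + e"] AE_I2) 
             (auto, smt (verit))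
      qed (use i1 i2 in auto)
      moreover have "\<bar>u z - v z\<bar> + norm (g z * of_real (u z) - g z * of_real (v z)) = 
          \<bar>u z - v z\<bar> * (1 + norm (g z))" for z
        by (simp add: norm_mult algebra_simps flip: right_diff_distrib of_real_diff)
      ultimately show "integrable torus_measure (\<lambda>z. \<bar>u z - v z\<bar> * (1 + norm (g z)))"
        by simp
      show "norm (g z * of_real (u z) - g z * of_real (v z)) \<le> \<bar>u z - v z\<bar> * (1 + norm (g z))" for z
        by (simp add: norm_mult algebra_simps flip: right_diff_distrib of_real_diff)
    qed
    finally show ?thesis using v(3) by simp
  qed
  then have "norm (\<integral>z. g z * of_real (u z) \<partial>torus_measure) \<le> 0"
    by (rule field_le_epsilon) auto
  then show ?thesis by simp
qed

text \<open>
  The functions \<open>sgn (Re g)\<close> and \<open>sgn (Im g)\<close> as test functions recover the \<open>L1\<close> norms of \<open>Re g\<close>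
  and \<open>Im g\<close>.
\<close>

lemma AE_0_of_fourier_coeffs_0:
  assumes g: "integrable torus_measure g"
    and vanish: "\<And>\<nu>. \<nu> \<in> Z0_inf \<Longrightarrow> (\<integral>z. g z * character \<nu> z \<partial>torus_measure) = 0"
  shows "AE z in torus_measure. g z = 0"
proof -
  have [measurable]: "g \<in> borel_measurable torus_measure" using g by auto
  have i: "integrable torus_measure (\<lambda>z. g z * of_real (sgn (h z)))" 
    if [measurable]: "h \<in> borel_measurable torus_measure" for h :: "_ \<Rightarrow> real"
    by (rule integrable_times_bounded[OF g, where B = 1]) (auto simp: sgn_real_def)
  have "AE z in torus_measure. \<bar>Re (g z)\<bar> = 0"
  proof (subst integral_nonneg_eq_0_iff_AE[symmetric])
    have "(\<integral>z. \<bar>Re (g z)\<bar> \<partial>torus_measure) = (\<integral>z. Re (g z * of_real (sgn (Re (g z)))) \<partial>torus_measure)"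
      by (intro Bochner_Integration.integral_cong) (auto simp: sgn_real_def)
    also have "\<dots> = Re (\<integral>z. g z * of_real (sgn (Re (g z))) \<partial>torus_measure)"
      by (intro integral_Re i) auto
    also have "\<dots> = 0"
      using integral_eq_0_of_fourier_coeffs_0[OF g vanish, of "\<lambda>z. sgn (Re (g z))"] 
      by (simp add: sgn_real_def)
    finally show "(\<integral>z. \<bar>Re (g z)\<bar> \<partial>torus_measure) = 0" .
  qed (use g in auto)
  moreover have "AE z in torus_measure. \<bar>Im (g z)\<bar> = 0"
  proof (subst integral_nonneg_eq_0_iff_AE[symmetric])
    have "(\<integral>z. \<bar>Im (g z)\<bar> \<partial>torus_measure) = (\<integral>z. Im (g z * of_real (sgn (Im (g z)))) \<partial>torus_measure)"
      by (intro Bochner_Integration.integral_cong) (auto simp: sgn_real_def)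
    also have "\<dots> = Im (\<integral>z. g z * of_real (sgn (Im (g z))) \<partial>torus_measure)"
      by (intro integral_Im i) auto
    also have "\<dots> = 0"
      using integral_eq_0_of_fourier_coeffs_0[OF g vanish, of "\<lambda>z. sgn (Im (g z))"] 
      by (simp add: sgn_real_def)
    finally show "(\<integral>z. \<bar>Im (g z)\<bar> \<partial>torus_measure) = 0" .
  qed (use g in auto)
  ultimately show ?thesis
    by eventually_elim (auto simp: complex_eq_iff)
qed

section \<open>Jensen's inequality in exponential form\<close>

text \<open>
  Expand the exponential: positive frequencies are closed under addition, so all terms beyond the
  constant one are orthogonal to the conjugate of \<open>g\<close>. As \<open>q\<close> is bounded, the series may be
  integrated termwise.
\<close>

lemma integral_times_exp_trig_poly:
  assumes g: "integrable torus_measure g" and q: "q \<in> trig_poly pos_freq"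
    and vanish: "\<And>\<nu>. \<nu> \<in> pos_freq \<Longrightarrow> (\<integral>z. g z * character \<nu> z \<partial>torus_measure) = 0"
  shows "(\<integral>z. g z * exp (q z) \<partial>torus_measure) = (\<integral>z. g z \<partial>torus_measure)"
proof -
  obtain B where B: "0 \<le> B" "\<And>z. z \<in> torus \<Longrightarrow> norm (q z) \<le> B"
    using trig_poly_bounded[OF q] by blast
  have [measurable]: "q \<in> borel_measurable torus_measure"
    by (intro continuous_on_torus_measurable continuous_on_trig_poly[OF q])
  define F where "F k z = g z * (q z ^ k /\<^sub>R fact k)" for k z
  have norm_le: "norm (q z ^ k /\<^sub>R fact k) \<le> B ^ k /\<^sub>R fact k" if "z \<in> torus" for z k
    using power_mono[OF B(2)[OF that] norm_ge_zero, of k] 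
    by (simp add: norm_power divide_right_mono flip: divide_inverse_commute)
  have int: "integrable torus_measure (F k)" for k
    unfolding F_def
    by (rule integrable_times_bounded[OF g, where B = "B ^ k /\<^sub>R fact k"]) (use norm_le in auto)
  have normF: "norm (F k z) \<le> norm (g z) * (B ^ k /\<^sub>R fact k)" if "z \<in> torus" for k z
    unfolding F_def norm_mult by (intro mult_left_mono norm_le that) auto
  have sumB: "summable (\<lambda>k. c * (B ^ k /\<^sub>R fact k))" for c
    using summable_exp_generic[of B] by (rule summable_mult)
  have "(\<lambda>k. \<integral>z. F k z \<partial>torus_measure) sums (\<integral>z. (\<Sum>k. F k z) \<partial>torus_measure)"
  proof (rule sums_integral[OF int])
    show "AE z in torus_measure. summable (\<lambda>k. norm (F k z))"
      using normF by (intro AE_I2 summable_comparison_test'[OF sumB]) auto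
    show "summable (\<lambda>k. \<integral>z. norm (F k z) \<partial>torus_measure)"
    proof (rule summable_comparison_test'[OF sumB])
      fix k
      have "(\<integral>z. norm (F k z) \<partial>torus_measure) \<le> (\<integral>z. norm (g z) * (B ^ k /\<^sub>R fact k) \<partial>torus_measure)"
        using g int normF by (intro integral_mono) auto
      also have "\<dots> = (\<integral>z. norm (g z) \<partial>torus_measure) * (B ^ k /\<^sub>R fact k)"
        by (rule integral_mult_left_zero)
      finally show "norm (\<integral>z. norm (F k z) \<partial>torus_measure) \<le> 
          (\<integral>z. norm (g z) \<partial>torus_measure) * (B ^ k /\<^sub>R fact k)"
        by simp
    qed
  qed
  moreover have "(\<Sum>k. F k z) = g z * exp (q z)" for z
    unfolding F_def exp_def by (intro suminf_mult summable_exp_generic)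
  moreover have "(\<integral>z. F k z \<partial>torus_measure) = (if k = 0 then (\<integral>z. g z \<partial>torus_measure) else 0)" for k
  proof (cases k)
    case (Suc j)
    obtain r where r: "r \<in> trig_poly pos_freq" "\<And>z. z \<in> torus \<Longrightarrow> r z = q z ^ Suc j"
      using trig_poly_power[OF q] by blast
    have "(\<integral>z. F k z \<partial>torus_measure) = (\<integral>z. (g z * r z) /\<^sub>R fact k \<partial>torus_measure)"
      by (intro Bochner_Integration.integral_cong) (auto simp: F_def Suc r)
    also have "\<dots> = (\<integral>z. g z * r z \<partial>torus_measure) /\<^sub>R fact k"
      by (rule integral_scaleR_right)
    also have "(\<integral>z. g z * r z \<partial>torus_measure) = 0"
      using g r(1) vanish by (rule integral_times_trig_poly_eq_0)
    finally show ?thesis by (simp add: Suc)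
  qed (simp add: F_def)
  ultimately have "(\<lambda>k. if k = 0 then (\<integral>z. g z \<partial>torus_measure) else 0) sums 
      (\<integral>z. g z * exp (q z) \<partial>torus_measure)"
    by simp
  moreover have "(\<lambda>k. if k = 0 then (\<integral>z. g z \<partial>torus_measure) else 0) sums (\<integral>z. g z \<partial>torus_measure)"
    using sums_single[of 0 "\<lambda>_. \<integral>z. g z \<partial>torus_measure"] by simp
  ultimately show ?thesis by (rule sums_unique2)
qed

text \<open>
  A negative frequency can be moved into the positive cone by conjugating its term, which does not
  change the real part. Here the order has to be total.
\<close>

lemma Re_trig_poly_eq_Re_analytic:
  assumes "p \<in> trig_poly Z0_inf"
  shows "\<exists>c::real. \<exists>q\<in>trig_poly pos_freq. \<forall>z\<in>torus. Re (p z) = c + Re (q z)"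
  using assms
proof induction
  case zero
  then show ?case by (intro exI[of _ 0] bexI[OF _ trig_poly.zero]) simp
next
  case (add_character p \<nu> d)
  then obtain c q where q: "q \<in> trig_poly pos_freq" "\<And>z. z \<in> torus \<Longrightarrow> Re (p z) = c + Re (q z)"
    by blast
  from pos_freq_trichotomy[OF add_character.hyps(2)]
  consider "\<nu> = (\<lambda>_. 0)" | "\<nu> \<in> pos_freq" | "(\<lambda>n. - \<nu> n) \<in> pos_freq" by blast
  then show ?case
  proof cases
    case 1
    then show ?thesis
      using q by (intro exI[of _ "c + Re d"] bexI[of _ q]) (simp_all add: character_0)
  next
    case 2
    then show ?thesis
      using q by (intro exI[of _ c] bexI[OF _ trig_poly.add_character[OF q(1) 2, of d]]) simp
  next
    case 3
    then show ?thesis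
      using q by (intro exI[of _ c] bexI[OF _ trig_poly.add_character[OF q(1) 3, of "cnj d"]])
        (simp add: character_uminus)
  qed
qed

text \<open>
  Writing \<open>u = c + Re q\<close>, the constant \<open>c\<close> is the mean of \<open>u\<close> and
  \<open>|exp q| = exp (u - c)\<close>; the inequality is \<open>|\<integral> g exp q| \<le> \<integral> |g exp q|\<close>.
\<close>

lemma exp_mean_real_trig_poly_le:
  assumes g: "integrable torus_measure g"
    and vanish: "\<And>\<nu>. \<nu> \<in> pos_freq \<Longrightarrow> (\<integral>z. g z * character \<nu> z \<partial>torus_measure) = 0"
    and u: "real_trig_poly u"
  shows "norm (\<integral>z. g z \<partial>torus_measure) * exp (\<integral>z. u z \<partial>torus_measure) \<le> 
    (\<integral>z. norm (g z) * exp (u z) \<partial>torus_measure)"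
proof -
  obtain p where p: "p \<in> trig_poly Z0_inf" "\<And>z. z \<in> torus \<Longrightarrow> of_real (u z) = p z"
    using u by (auto simp: real_trig_poly_def)
  obtain c q where q: "q \<in> trig_poly pos_freq" and cq: "\<And>z. z \<in> torus \<Longrightarrow> Re (p z) = c + Re (q z)"
    using Re_trig_poly_eq_Re_analytic[OF p(1)] by blast
  have uq: "u z = c + Re (q z)" if "z \<in> torus" for z
    using p(2)[OF that] cq[OF that] by (metis Re_complex_of_real)
  have intq: "integrable torus_measure q" 
    using integrable_times_trig_poly[of "\<lambda>_. 1", OF _ q] by simp
  have "(\<integral>z. 1 * q z \<partial>torus_measure) = 0"
  proof (rule integral_times_trig_poly_eq_0[OF _ q])
    fix \<nu> assume "\<nu> \<in> pos_freq"
    then have "\<nu> \<in> Z0_inf" "\<nu> \<noteq> (\<lambda>_. 0)"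
      using pos_freq_subset zero_notin_pos_freq by auto
    then show "(\<integral>z. 1 * character \<nu> z \<partial>torus_measure) = 0"
      by (simp add: integral_character)
  qed simp
  then have "(\<integral>z. Re (q z) \<partial>torus_measure) = 0"
    using integral_Re[OF intq] by simp
  moreover have "(\<integral>z. u z \<partial>torus_measure) = (\<integral>z. c + Re (q z) \<partial>torus_measure)"
    using uq by (intro Bochner_Integration.integral_cong) auto
  ultimately have c: "(\<integral>z. u z \<partial>torus_measure) = c"
    using intq by (simp add: torus.prob_space)
  have "norm (\<integral>z. g z \<partial>torus_measure) = norm (\<integral>z. g z * exp (q z) \<partial>torus_measure)"
    using integral_times_exp_trig_poly[OF g q vanish] by simp
  also have "\<dots> \<le> (\<integral>z. norm (g z * exp (q z)) \<partial>torus_measure)"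
    by (rule integral_norm_bound)
  also have "\<dots> = (\<integral>z. exp (- c) * (norm (g z) * exp (u z)) \<partial>torus_measure)"
    by (intro Bochner_Integration.integral_cong) (auto simp: norm_mult uq exp_add exp_minus)
  also have "\<dots> = exp (- c) * (\<integral>z. norm (g z) * exp (u z) \<partial>torus_measure)"
    by simp
  finally show ?thesis
    unfolding c by (simp add: exp_minus field_simps)
qed

text \<open>
  The passage from real trigonometric polynomials to bounded functions. The exponential is Lipschitz
  on the common range of \<open>u\<close> and its approximants, so both sides converge.
\<close>

lemma exp_mean_le:
  assumes g: "integrable torus_measure g"
    and vanish: "\<And>\<nu>. \<nu> \<in> pos_freq \<Longrightarrow> (\<integral>z. g z * character \<nu> z \<partial>torus_measure) = 0"
    and u [measurable]: "u \<in> borel_measurable torus_measure"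
    and C: "\<And>z. z \<in> torus \<Longrightarrow> \<bar>u z\<bar> \<le> C"
  shows "norm (\<integral>z. g z \<partial>torus_measure) * exp (\<integral>z. u z \<partial>torus_measure) \<le> 
    (\<integral>z. norm (g z) * exp (u z) \<partial>torus_measure)"
proof -
  \<comment> \<open>A Lipschitz constant of \<open>exp\<close> below \<open>C + 1\<close>, where all approximants with \<open>e \<le> 1\<close> stay.\<close>
  define K where "K = exp (C + 1)"
  have K: "0 < K" by (simp add: K_def)
  let ?a = "norm (\<integral>z. g z \<partial>torus_measure)"
  let ?R = "\<integral>z. norm (g z) * exp (u z) \<partial>torus_measure"
  have [measurable]: "g \<in> borel_measurable torus_measure" using g by auto
  have intu: "integrable torus_measure u"
    using C by (intro torus.integrable_const_bound[where B = C]) auto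
  have intge: "integrable torus_measure (\<lambda>z. norm (g z) * exp (h z))"
    if [measurable]: "h \<in> borel_measurable torus_measure" and "\<And>z. z \<in> torus \<Longrightarrow> h z \<le> C + 1" for h
  proof (rule Bochner_Integration.integrable_bound[where f = "\<lambda>z. K * norm (g z)"])
    show "AE z in torus_measure. norm (norm (g z) * exp (h z)) \<le> norm (K * norm (g z))"
      using K that(2) by (intro AE_I2) (auto simp: abs_mult K_def mult.commute intro!: mult_left_mono)
  qed (use g in auto)
  have approx: "?a * exp ((\<integral>z. u z \<partial>torus_measure) - e) \<le> ?R + K * e" if e: "0 < e" "e \<le> 1" for e
  proof -
    obtain v where v: "real_trig_poly v" "\<And>z. z \<in> torus \<Longrightarrow> \<bar>v z\<bar> \<le> C + e"
      "(\<integral>z. \<bar>u z - v z\<bar> * (1 + norm (g z)) \<partial>torus_measure) < e"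
      using real_trig_poly_dense_L1[of "\<lambda>z. norm (g z)" u C e] g u C e by auto
    have [measurable]: "v \<in> borel_measurable torus_measure"
      by (intro continuous_on_torus_measurable continuous_on_real_trig_poly v)
    have vC: "\<bar>v z\<bar> \<le> C + 1" if "z \<in> torus" for z
      using v(2)[OF that] e by linarith
    have uC: "\<bar>u z\<bar> \<le> C + 1" if "z \<in> torus" for z
      using C[OF that] by linarith
    have intv: "integrable torus_measure v"
      using vC by (intro torus.integrable_const_bound[where B = "C + 1"]) auto
    have int: "integrable torus_measure (\<lambda>z. \<bar>u z - v z\<bar> * (1 + norm (g z)))"
    proof (rule Bochner_Integration.integrable_bound[where f = "\<lambda>z. 2 * (C + 1) * (1 + norm (g z))"])
      have "\<bar>u z - v z\<bar> * (1 + norm (g z)) \<le> 2 * (C + 1) * (1 + norm (g z))" if "z \<in> torus" for z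
        using abs_triangle_ineq4[of "u z" "v z"] uC[OF that] vC[OF that]
        by (intro mult_right_mono) auto
      then show "AE z in torus_measure. norm (\<bar>u z - v z\<bar> * (1 + norm (g z))) 
          \<le> norm (2 * (C + 1) * (1 + norm (g z)))"
        by (intro AE_I2) (fastforce intro: order_trans[OF _ abs_ge_self])
    qed (use g in auto)
    have "(\<integral>z. u z \<partial>torus_measure) - (\<integral>z. v z \<partial>torus_measure) = (\<integral>z. u z - v z \<partial>torus_measure)"
      using intu intv by simp
    also have "\<dots> \<le> (\<integral>z. \<bar>u z - v z\<bar> * (1 + norm (g z)) \<partial>torus_measure)"
    proof (rule integral_mono[OF _ int])
      show "u z - v z \<le> \<bar>u z - v z\<bar> * (1 + norm (g z))" for z
        using mult_left_mono[of 1 "1 + norm (g z)" "\<bar>u z - v z\<bar>"] by simp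
    qed (use intu intv in auto)
    finally have "(\<integral>z. u z \<partial>torus_measure) - e \<le> (\<integral>z. v z \<partial>torus_measure)"
      using v(3) by linarith
    then have "?a * exp ((\<integral>z. u z \<partial>torus_measure) - e) \<le> ?a * exp (\<integral>z. v z \<partial>torus_measure)"
      by (intro mult_left_mono) auto
    also have "\<dots> \<le> (\<integral>z. norm (g z) * exp (v z) \<partial>torus_measure)"
      using g vanish v(1) by (rule exp_mean_real_trig_poly_le)
    also have "\<dots> \<le> (\<integral>z. norm (g z) * exp (u z) + K * (\<bar>u z - v z\<bar> * (1 + norm (g z))) \<partial>torus_measure)"
    proof (rule integral_mono)
      show "integrable torus_measure (\<lambda>z. norm (g z) * exp (v z))"
        using vC by (intro intge) (auto simp: abs_le_iff)
      show "integrable torus_measure (\<lambda>z. norm (g z) * exp (u z) + K * (\<bar>u z - v z\<bar> * (1 + norm (g z))))"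
        using uC int by (intro Bochner_Integration.integrable_add intge integrable_mult_right) (auto simp: abs_le_iff)
      fix z assume z: "z \<in> torus"
      \<comment> \<open>Convexity: the graph of \<open>exp\<close> lies above its tangent at \<open>v z\<close>.\<close>
      have "exp (v z) - exp (u z) \<le> exp (v z) * (v z - u z)"
        using mult_left_mono[OF exp_ge_add_one_self[of "u z - v z"], of "exp (v z)"] 
        by (simp add: algebra_simps flip: exp_add)
      also have "\<dots> \<le> exp (v z) * \<bar>u z - v z\<bar>"
        by (intro mult_left_mono) auto
      also have "\<dots> \<le> K * \<bar>u z - v z\<bar>"
        unfolding K_def using vC[OF z] by (intro mult_right_mono) (auto simp: abs_le_iff)
      finally have "norm (g z) * (exp (v z) - exp (u z)) \<le> norm (g z) * (K * \<bar>u z - v z\<bar>)"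
        by (intro mult_left_mono) auto
      also have "\<dots> \<le> K * (\<bar>u z - v z\<bar> * (1 + norm (g z)))"
        using K by (simp add: algebra_simps)
      finally show "norm (g z) * exp (v z) \<le> 
          norm (g z) * exp (u z) + K * (\<bar>u z - v z\<bar> * (1 + norm (g z)))"
        by (simp add: algebra_simps)
    qed
    also have "\<dots> = ?R + K * (\<integral>z. \<bar>u z - v z\<bar> * (1 + norm (g z)) \<partial>torus_measure)"
      using uC int by (subst Bochner_Integration.integral_add) (auto simp: abs_le_iff intro!: intge)
    also have "\<dots> \<le> ?R + K * e"
      using v(3) K by (intro add_left_mono mult_left_mono) auto
    finally show ?thesis .
  qed
  have "((\<lambda>e. ?a * exp ((\<integral>z. u z \<partial>torus_measure) - e)) \<longlongrightarrow> ?a * exp ((\<integral>z. u z \<partial>torus_measure) - 0)) (at_right 0)"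
    by (intro tendsto_intros)
  moreover have "((\<lambda>e. ?R + K * e) \<longlongrightarrow> ?R + K * 0) (at_right 0)"
    by (intro tendsto_intros)
  moreover have "eventually (\<lambda>e. ?a * exp ((\<integral>z. u z \<partial>torus_measure) - e) \<le> ?R + K * e) (at_right 0)"
    using approx by (intro eventually_at_rightI[of 0 1]) auto
  ultimately have "?a * exp ((\<integral>z. u z \<partial>torus_measure) - 0) \<le> ?R + K * 0"
    using tendsto_le[OF trivial_limit_at_right_real] by blast
  then show ?thesis by simp
qed

section \<open>Integrability of the logarithm\<close>

text \<open>
  The test functions are the truncations \<open>u n = min n (max 0 (- log |g|))\<close>. They are written with the
  truncation inside the logarithm, so that \<open>u n = n\<close> where \<open>g\<close> vanishes even though \<open>ln 0 = 0\<close>.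
  The bound on \<open>\<integral> u n\<close> then also shows that the zero set of \<open>g\<close> is null.
\<close>

lemma log_integrable_of_mean_nonzero:
  assumes g: "integrable torus_measure g"
    and vanish: "\<And>\<nu>. \<nu> \<in> pos_freq \<Longrightarrow> (\<integral>z. g z * character \<nu> z \<partial>torus_measure) = 0"
    and mean: "(\<integral>z. g z \<partial>torus_measure) \<noteq> 0"
  shows "(AE z in torus_measure. g z \<noteq> 0) \<and> integrable torus_measure (\<lambda>z. ln (norm (g z)))"
proof -
  have [measurable]: "g \<in> borel_measurable torus_measure" using g by auto
  define u where "u n z = - ln (max (exp (- real n)) (min 1 (norm (g z))))" for n :: nat and z
  have [measurable]: "u n \<in> borel_measurable torus_measure" for n
    unfolding u_def by measurable
  have u0: "0 \<le> u n z" for n z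
  proof -
    have "ln (max (exp (- real n)) (min 1 (norm (g z)))) \<le> ln 1"
      by (subst ln_le_cancel_iff) (auto simp: less_max_iff_disj)
    then show ?thesis by (simp add: u_def)
  qed
  have un: "u n z \<le> real n" for n z
  proof -
    have "ln (exp (- real n)) \<le> ln (max (exp (- real n)) (min 1 (norm (g z))))"
      by (subst ln_le_cancel_iff) (auto simp: max_def)
    then show ?thesis by (simp add: u_def)
  qed
  have ge: "norm (g z) * exp (u n z) \<le> 1 + norm (g z)" for n z
  proof -
    have m: "0 < max (exp (- real n)) (min 1 (norm (g z)))" by (simp add: less_max_iff_disj)
    have "norm (g z) * exp (u n z) = norm (g z) / max (exp (- real n)) (min 1 (norm (g z)))"
      unfolding u_def using m by (simp only: exp_minus[of "ln _"] exp_ln divide_inverse)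
    also have "\<dots> \<le> 1 + norm (g z)"
    proof (subst pos_divide_le_eq[OF m])
      have "norm (g z) \<le> (1 + norm (g z)) * min 1 (norm (g z))"
        by (auto simp: min_def distrib_right)
      also have "\<dots> \<le> (1 + norm (g z)) * max (exp (- real n)) (min 1 (norm (g z)))"
        by (intro mult_left_mono) auto
      finally show "norm (g z) \<le> (1 + norm (g z)) * max (exp (- real n)) (min 1 (norm (g z)))" .
    qed
    finally show ?thesis .
  qed
  have intu: "integrable torus_measure (u n)" for n
    using u0 un by (intro torus.integrable_const_bound[where B = "real n"]) auto
  define a where "a = norm (\<integral>z. g z \<partial>torus_measure)"
  define K where "K = ln ((1 + (\<integral>z. norm (g z) \<partial>torus_measure)) / a)"
  have a0: "0 < a" using mean by (simp add: a_def)
  have bound: "(\<integral>z. u n z \<partial>torus_measure) \<le> K" for n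
  proof -
    have "a * exp (\<integral>z. u n z \<partial>torus_measure) \<le> (\<integral>z. norm (g z) * exp (u n z) \<partial>torus_measure)"
      unfolding a_def using u0 un by (intro exp_mean_le[OF g vanish, where C = "real n"]) auto
    also have "\<dots> \<le> (\<integral>z. 1 + norm (g z) \<partial>torus_measure)"
      using g ge by (intro integral_mono') auto
    also have "\<dots> = 1 + (\<integral>z. norm (g z) \<partial>torus_measure)"
      using g by (simp add: torus.prob_space)
    finally have "exp (\<integral>z. u n z \<partial>torus_measure) \<le> (1 + (\<integral>z. norm (g z) \<partial>torus_measure)) / a"
      using a0 by (simp add: pos_le_divide_eq mult.commute)
    then show ?thesis
      unfolding K_def by (metis exp_gt_zero ln_exp ln_mono)
  qed
  have nonzero: "AE z in torus_measure. g z \<noteq> 0"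
  proof -
    define Z where "Z = {z \<in> torus. g z = 0}"
    have [measurable]: "Z \<in> sets torus_measure" unfolding Z_def by measurable
    have "real n * measure torus_measure Z \<le> K" for n
    proof -
      have "real n * measure torus_measure Z = (\<integral>z. real n * indicator Z z \<partial>torus_measure)"
        by simp
      also have "\<dots> \<le> (\<integral>z. u n z \<partial>torus_measure)"
        using intu
      proof (rule integral_mono')
        show "real n * indicator Z z \<le> u n z" for z
          using u0[of n z] by (auto simp: Z_def u_def indicator_def)
      qed (rule u0)
      finally show ?thesis using bound[of n] by simp
    qed
    then have "measure torus_measure Z = 0"
      by (metis linorder_not_le measure_nonneg order_le_less reals_Archimedean3)
    then have "emeasure torus_measure Z = 0"
      by (simp add: torus.emeasure_eq_measure)
    then show ?thesis
      by (intro AE_I[of _ _ Z]) (auto simp: Z_def)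
  qed
  define L where "L z = max 0 (- ln (norm (g z)))" for z
  have [measurable]: "L \<in> borel_measurable torus_measure"
    unfolding L_def by measurable
  have uL: "u n z = min (real n) (L z)" if "g z \<noteq> 0" for n z
  proof -
    have "u n z = - max (ln (exp (- real n))) (min (ln 1) (ln (norm (g z))))"
      unfolding u_def using that ln_ge_iff[of "norm (g z)" "- real n"]
      by (auto simp: max_def min_def not_le)
    then show ?thesis by (simp add: L_def)
  qed
  have mono: "incseq (\<lambda>n. \<integral>z. u n z \<partial>torus_measure)"
  proof (rule incseq_SucI)
    show "(\<integral>z. u n z \<partial>torus_measure) \<le> (\<integral>z. u (Suc n) z \<partial>torus_measure)" for n
      by (rule integral_mono_AE[OF intu intu]) (use nonzero in eventually_elim, simp add: uL)
  qed
  then obtain l where l: "(\<lambda>n. \<integral>z. u n z \<partial>torus_measure) \<longlonglongrightarrow> l"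
    using bound incseq_convergent by metis
  have "integrable torus_measure L"
  proof (rule integrable_monotone_convergence[OF intu _ _ l])
    show "AE z in torus_measure. mono (\<lambda>n. u n z)"
      using nonzero by eventually_elim (auto simp: uL mono_def)
    show "AE z in torus_measure. (\<lambda>n. u n z) \<longlonglongrightarrow> L z"
      using nonzero
    proof eventually_elim
      case (elim z)
      obtain N where N: "L z \<le> real N" using real_arch_simple by blast
      have "eventually (\<lambda>n. u n z = L z) sequentially"
        using eventually_ge_at_top[of N] by eventually_elim (use N elim in \<open>auto simp: uL\<close>)
      then show ?case by (rule tendsto_eventually)
    qed
  qed simp
  then have "integrable torus_measure (\<lambda>z. norm (g z) + L z)"
    using g by auto
  then have "integrable torus_measure (\<lambda>z. ln (norm (g z)))"
  proof (rule Bochner_Integration.integrable_bound)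
    show "AE z in torus_measure. norm (ln (norm (g z))) \<le> norm (norm (g z) + L z)"
      using nonzero
    proof eventually_elim
      case (elim z)
      then have "ln (norm (g z)) \<le> norm (g z)"
        using ln_bound[of "norm (g z)"] by simp
      then show ?case
        using norm_ge_zero[of "g z"] by (simp add: L_def max_def abs_if)
    qed
  qed simp
  with nonzero show ?thesis by blast
qed

(* log|f| takes the value -infinity where f = 0, whereas ln 0 = 0 here, so the finiteness
   of log|f| almost everywhere is a separate conjunct. *)
theorem corollary2:
  fixes f :: "(nat \<Rightarrow> complex) \<Rightarrow> complex"
  assumes "f \<in> H1_inf"
    and "\<not> (AE z in torus_measure. f z = 0)"
  shows "(AE z in torus_measure. f z \<noteq> 0) \<and> integrable torus_measure (\<lambda>z. ln (norm (f z)))"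
proof -
  have f: "integrable torus_measure f"
    and vanish: "\<And>\<nu>. \<nu> \<in> Z0_inf - N0_inf \<Longrightarrow> fourier_coeff f \<nu> = 0"
    using assms(1) by (auto simp: H1_inf_def)
  define X where "X = {\<nu> \<in> Z0_inf. fourier_coeff f \<nu> \<noteq> 0}"
  have "X \<subseteq> N0_inf" using vanish by (auto simp: X_def)
  moreover have "X \<noteq> {}"
  proof
    assume "X = {}"
    then have "fourier_coeff f (\<lambda>n. - \<nu> n) = 0" if "\<nu> \<in> Z0_inf" for \<nu>
      using Z0_inf_uminus[OF that] by (auto simp: X_def)
    then have "AE z in torus_measure. f z = 0"
      by (intro AE_0_of_fourier_coeffs_0[OF f]) (simp add: fourier_coeff_character)
    with assms(2) show False by blast
  qed
  ultimately obtain m where m: "m \<in> X" 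
    and m_min: "\<And>x. x \<in> X \<Longrightarrow> x = m \<or> (\<lambda>n. x n - m n) \<in> pos_freq"
    using N0_inf_has_min[of X] by blast
  have mZ: "m \<in> Z0_inf" using m by (simp add: X_def)
  define g where "g z = f z * character (\<lambda>n. - m n) z" for z
  have g: "integrable torus_measure g"
    unfolding g_def using norm_character by (intro integrable_times_bounded[OF f, where B = 1]) auto
  have norm_g: "norm (g z) = norm (f z)" if "z \<in> torus" for z
    using that by (simp add: g_def norm_mult norm_character)
  \<comment> \<open>A non-zero integral here would put the frequency \<open>m - \<mu>\<close>, which lies below \<open>m\<close>, into \<open>X\<close>.\<close>
  have "(\<integral>z. g z * character \<mu> z \<partial>torus_measure) = 0" if \<mu>: "\<mu> \<in> pos_freq" for \<mu>
  proof -
    have \<mu>Z: "\<mu> \<in> Z0_inf" using \<mu> pos_freq_subset by blast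
    have "(\<integral>z. g z * character \<mu> z \<partial>torus_measure) = fourier_coeff f (\<lambda>n. m n - \<mu> n)"
      unfolding fourier_coeff_character g_def
      using character_add[OF Z0_inf_uminus[OF mZ] \<mu>Z]
      by (intro Bochner_Integration.integral_cong) auto
    moreover have "(\<lambda>n. m n - \<mu> n) \<notin> X"
    proof
      assume "(\<lambda>n. m n - \<mu> n) \<in> X"
      then consider "(\<lambda>n. m n - \<mu> n) = m" | "(\<lambda>n. - \<mu> n) \<in> pos_freq"
        using m_min[of "\<lambda>n. m n - \<mu> n"] by auto
      then show False
      proof cases
        case 1
        then have "\<mu> = (\<lambda>_. 0)" by (auto simp: fun_eq_iff)
        then show False using \<mu> zero_notin_pos_freq by simp
      next
        case 2
        then show False using pos_freq_add[OF \<mu> 2] zero_notin_pos_freq by simp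
      qed
    qed
    moreover have "(\<lambda>n. m n - \<mu> n) \<in> Z0_inf"
      using Z0_inf_add[OF mZ Z0_inf_uminus[OF \<mu>Z]] by simp
    ultimately show ?thesis by (simp add: X_def)
  qed
  moreover have "(\<integral>z. g z \<partial>torus_measure) \<noteq> 0"
    using m by (simp add: X_def g_def fourier_coeff_character)
  ultimately have "(AE z in torus_measure. g z \<noteq> 0) \<and> integrable torus_measure (\<lambda>z. ln (norm (g z)))"
    by (intro log_integrable_of_mean_nonzero g)
  moreover have "(AE z in torus_measure. g z \<noteq> 0) \<longleftrightarrow> (AE z in torus_measure. f z \<noteq> 0)"
    using norm_g by (intro AE_cong) (metis norm_eq_zero)
  moreover have "integrable torus_measure (\<lambda>z. ln (norm (g z))) \<longleftrightarrow> 
      integrable torus_measure (\<lambda>z. ln (norm (f z)))"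
    using norm_g by (intro Bochner_Integration.integrable_cong) auto
  ultimately show ?thesis by blast
qed

end
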